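(* Let $\log$ denote the logarithm to base $2$. For an integer $l \ge 1$ let $\mathcal{P}^{(l)}$ be the set of primes in $\{1,\dots,l\}$. (i) For every $\eta>0$ there exist $\rho>0$ and $l_0$ such that for every integer $l\ge l_0$ and every finite set $S\subset \mathbb{Z}$ with $\log |S| \le \rho\, \frac{l}{\log l}$ one has \[ |\{ (p,p',s,s') \in \mathcal{P}^{(l)} \times \mathcal{P}^{(l)} \times S \times S ~:~ ps = p's' \}| \le \eta\, |\mathcal{P}^{(l)}|^2 |S| . \] That is, $\log|S| = o(l/\log l)$ implies that this count is $o(|\mathcal{P}^{(l)}|^2|S|)$. (ii) For every $K\ge 1$ there is a constant $C_K>0$ such that the following holds. Let $S\subset\mathbb{Z}$ be finite with $|S|\ge 3$ and $|SS|\le K|S|$. Then every arithmetic progression with the beginning at zero contained in $S$ has length at most $C_K \log|S|\cdot \log\log|S|$.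
   Context: $SS=\{s s' : s,s'\in S\}$ is the product set. An arithmetic progression with the beginning at zero is a set of the form $\{d,2d,\dots,nd\}$ with $d$ a nonzero integer, possibly together with the term $0$; this changes the length by one. Its length is $n$.
   Formalization: Part (i) fails as stated for small sets containing 0 (S={0} has |P|^2 solutions, too many if η<1); it is proved under the added condition that if 0 is in S then η|S|>1, which is necessary except in the trivial instance S={0}, η=1. *)

theory Defs
  imports Complex_Main "HOL-Computational_Algebra.Primes" "HOL-Library.Set_Algebras"
begin

text \<open>Product sets are \<^term>\<open>S * S\<close> for the pointwise product of sets from
  \<^theory>\<open>HOL-Library.Set_Algebras\<close>.\<close>

definition primes_upto :: "nat \<Rightarrow> int set" where
  "primes_upto l = {p \<in> {1..int l}. prime p}"

definition prime_quadruples :: "nat \<Rightarrow> int set \<Rightarrow> (int \<times> int \<times> int \<times> int) set" where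
  "prime_quadruples l S =
     {(p, p', s, s'). p \<in> primes_upto l \<and> p' \<in> primes_upto l \<and> s \<in> S \<and> s' \<in> S \<and> p * s = p' * s'}"

text \<open>\<open>ap_from_zero A k\<close>: the set \<open>A\<close> is an arithmetic progression with the beginning at zero,
  of length \<open>k\<close>. The term \<open>0\<close> is optional; it is counted in the length when present.\<close>

definition ap_from_zero :: "int set \<Rightarrow> nat \<Rightarrow> bool" where
  "ap_from_zero A k \<longleftrightarrow>
     (\<exists>(d::int) (n::nat). d \<noteq> 0 \<and> n \<ge> 1 \<and>
        (A = (\<lambda>i. int i * d) ` {1..n} \<and> k = n \<or>
         A = insert 0 ((\<lambda>i. int i * d) ` {1..n}) \<and> k = n + 1))"

lemma ap_from_zero_card:
  assumes "ap_from_zero A k"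
  shows "card A = k"
proof -
  obtain d :: int and n :: nat where d: "d \<noteq> 0" and A:
    "A = (\<lambda>i. int i * d) ` {1..n} \<and> k = n \<or>
     A = insert 0 ((\<lambda>i. int i * d) ` {1..n}) \<and> k = n + 1"
    using assms unfolding ap_from_zero_def by blast
  have "inj_on (\<lambda>i. int i * d) {1..n}"
    using d by (auto simp: inj_on_def)
  then have "card ((\<lambda>i. int i * d) ` {1..n}) = n"
    by (simp add: card_image)
  moreover have "0 \<notin> (\<lambda>i. int i * d) ` {1..n}"
    using d by auto
  ultimately show ?thesis
    using A by auto
qed

lemma finite_primes_upto: "finite (primes_upto l)"
  unfolding primes_upto_def by (rule finite_subset[of _ "{1..int l}"]) auto

lemma finite_prime_quadruples:
  assumes "finite S"
  shows "finite (prime_quadruples l S)"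
  by (rule finite_subset[of _ "primes_upto l \<times> primes_upto l \<times> S \<times> S"])
     (auto simp: prime_quadruples_def finite_primes_upto assms)

text \<open>If \<open>0 \<in> S\<close>, then \<open>s = s' = 0\<close> solves \<open>p s = p' s'\<close> for every pair of primes. Hence a bound
  \<open>\<eta> |P|\<^sup>2 |S|\<close> on the number of solutions, with \<open>P\<close> the primes up to \<open>l\<close>, is impossible for
  \<open>0 \<in> S \<noteq> {0}\<close> unless \<open>1 < \<eta> |S|\<close>, whatever \<open>l \<ge> 2\<close> is (and for \<open>S = {0}\<close> it just says
  \<open>1 \<le> \<eta>\<close>). The bound for sets containing \<open>0\<close> is therefore to be read under this condition.\<close>

lemma zero_mem_necessary:
  fixes \<eta> :: real
  assumes "finite S" "0 \<in> S" "S \<noteq> {0}" "l \<ge> 2"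
    and bound: "real (card (prime_quadruples l S)) \<le> \<eta> * real (card (primes_upto l))^2 * real (card S)"
  shows "1 < \<eta> * real (card S)"
proof -
  let ?P = "primes_upto l"
  let ?Z = "(\<lambda>(p, p'). (p, p', 0::int, 0::int)) ` (?P \<times> ?P)"
  obtain s where s: "s \<in> S" "s \<noteq> 0"
    using assms by blast
  have two: "2 \<in> ?P"
    using \<open>l \<ge> 2\<close> by (simp add: primes_upto_def)
  have "insert (2, 2, s, s) ?Z \<subseteq> prime_quadruples l S"
    using s two \<open>0 \<in> S\<close> by (auto simp: prime_quadruples_def)
  then have "card (insert (2, 2, s, s) ?Z) \<le> card (prime_quadruples l S)"
    by (intro card_mono finite_prime_quadruples assms)
  moreover have "card ?Z = card ?P ^ 2"
    by (subst card_image) (auto simp: inj_on_def card_cartesian_product power2_eq_square)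
  moreover have "(2, 2, s, s) \<notin> ?Z"
    using s by auto
  ultimately have "card ?P ^ 2 < card (prime_quadruples l S)"
    using finite_primes_upto[of l] by simp
  then have "real (card ?P ^ 2) < real (card (prime_quadruples l S))"
    by (simp only: of_nat_less_iff)
  also have "\<dots> \<le> \<eta> * real (card ?P)^2 * real (card S)"
    by (rule bound)
  finally have "real (card ?P)^2 * 1 < real (card ?P)^2 * (\<eta> * real (card S))"
    by (simp add: algebra_simps)
  then show ?thesis
    by (rule mult_left_less_imp_less) simp
qed

end

theory Submission
  imports Defs "HOL-Analysis.Convex" "HOL-Combinatorics.Multiset_Permutations"
begin

text \<open>
  Let \<open>P\<close> be the set of primes up to \<open>l\<close>, let \<open>0 \<notin> S\<close>, and let \<open>G\<close> be the symmetric matrix on \<open>S\<close>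
  with \<open>G(s,t) = |{(p,p') \<in> P \<times> P. p s = p' t}|\<close>. Its entries sum up to the number \<open>E\<close> of solutions.
  For \<open>k\<close> a power of two, repeated Cauchy--Schwarz gives \<open>(E / |S|)\<^sup>k \<le> (sum of the entries of G\<^sup>k) / |S|\<close>.
  An entry of \<open>G\<^sup>k\<close> is at most the number of solutions of
  \<open>p\<^sub>1 \<cdots> p\<^sub>k s = p'\<^sub>1 \<cdots> p'\<^sub>k t\<close>, which is at most \<open>k! |P|\<^sup>k\<close> by unique factorization. Choosing
  \<open>k\<close> of the order of \<open>log |S|\<close> yields \<open>E \<le> 4 max(1, log |S|) |P| |S|\<close>. Chebyshev's bound
  \<open>|P| \<ge> l / (3 log l)\<close> turns this into the first part.

  In the second part, a progression \<open>d, 2d, \<dots>, nd\<close> in \<open>S\<close> makes \<open>d P S\<close> a subset of \<open>S S\<close>,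
  where \<open>P\<close> is the set of primes up to \<open>n\<close>. Hence \<open>|P S| \<le> K |S|\<close>, so \<open>E\<close> is at least of the order
  of \<open>|P|\<^sup>2 |S| / K\<close>; comparing with the upper bound, \<open>|P|\<close> is at most of the order of \<open>K log |S|\<close>,
  and Chebyshev's bound limits \<open>n\<close>.
\<close>

section \<open>Chebyshev's lower bound\<close>

text \<open>Nair's argument, by descent in Leibniz's harmonic triangle: with \<open>L(n,m) = 1 / (m (n choose m))\<close>
  one has \<open>L(n,m+1) = L(n-1,m) - L(n,m)\<close>.\<close>

lemma mult_binomial_dvd_common_multiple:
  fixes M n m :: nat
  assumes M: "\<And>i. 1 \<le> i \<Longrightarrow> i \<le> n \<Longrightarrow> i dvd M" and m: "1 \<le> m" "m \<le> n"
  shows "m * (n choose m) dvd M"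
proof -
  have "real M / real (m * (n choose m)) \<in> \<int>"
    using m M
  proof (induction m arbitrary: n rule: dec_induct)
    case base
    then have "n dvd M" by auto
    then obtain c where "M = n * c" by blast
    then show ?case using base by simp
  next
    case (step k)
    define c where "c = (n - 1) choose k"
    define x where "x = n choose k"
    have pos: "c > 0" "x > 0" "k > 0" "n > 0"
      using step by (auto simp: c_def x_def)
    have "real ((n - k) * x) = real (n * c)"
      unfolding c_def x_def by (simp only: binomial_absorb_comp)
    then have nx: "(real n - real k) * real x = real n * real c"
      using step.prems by (simp add: of_nat_diff)
    have "real M / real (Suc k * (n choose Suc k)) = real M / (real n * real c)"
      unfolding binomial_absorption c_def by simp
    also have "\<dots> = real M / real (k * c) - real M / real (k * x)"
      using pos nx by (simp add: field_simps)
    also have "\<dots> \<in> \<int>"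
      unfolding c_def x_def using step by (intro Ints_diff step.IH) auto
    finally show ?case .
  qed
  then obtain z :: int where "real M / real (m * (n choose m)) = of_int z"
    by (auto elim: Ints_cases)
  then have "real M = of_int (z * int (m * (n choose m)))"
    using m by (simp add: field_simps)
  then have "int M = z * int (m * (n choose m))"
    by linarith
  then have "int (m * (n choose m)) dvd int M"
    by (metis dvd_triv_right)
  then show ?thesis
    by (simp only: int_dvd_int_iff)
qed

lemma common_multiple_le_power_card_primes:
  fixes n :: nat
  assumes "n \<ge> 1"
  obtains M :: nat where "M > 0" "M \<le> n ^ card {p. prime p \<and> p \<le> n}"
    "\<And>i. 1 \<le> i \<Longrightarrow> i \<le> n \<Longrightarrow> i dvd M"
proof -
  let ?P = "{p::nat. prime p \<and> p \<le> n}"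
  have fin: "finite ?P" by (rule finite_subset[of _ "{..n}"]) auto
  have "\<exists>e. p ^ e \<le> n \<and> n < p ^ (e + 1)" if "p \<in> ?P" for p
    using that assms by (intro ex_power_ivl1) (auto dest: prime_ge_2_nat)
  then obtain e where e: "\<And>p. p \<in> ?P \<Longrightarrow> p ^ e p \<le> n \<and> n < p ^ (e p + 1)"
    by metis
  define M where "M = (\<Prod>p\<in>?P. p ^ e p)"
  have "M > 0"
    unfolding M_def by (intro prod_pos) (auto simp: prime_gt_0_nat)
  moreover have "M \<le> n ^ card ?P"
    unfolding M_def using e by (subst prod_constant[symmetric], intro prod_mono) auto
  moreover have "i dvd M" if i: "1 \<le> i" "i \<le> n" for i
  proof (rule multiplicity_le_imp_dvd)
    fix p :: nat assume p: "prime p"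
    have mi: "p ^ multiplicity p i \<le> n"
      using i dvd_imp_le[OF multiplicity_dvd[of p i]] by linarith
    show "multiplicity p i \<le> multiplicity p M"
    proof (cases "p \<le> n")
      case True
      then have pP: "p \<in> ?P" using p by simp
      have "p ^ multiplicity p i < p ^ (e p + 1)"
        using e[OF pP] mi by linarith
      then have "multiplicity p i < e p + 1"
        using p prime_gt_1_nat power_less_imp_less_exp by blast
      moreover have "p ^ e p dvd M"
        unfolding M_def using fin pP by (intro dvd_prodI) 
      then have "e p \<le> multiplicity p M"
        using \<open>M > 0\<close> p by (intro multiplicity_geI) auto
      ultimately show ?thesis by simp
    next
      case False
      have "multiplicity p i = 0"
      proof (rule ccontr)
        assume "multiplicity p i \<noteq> 0"
        then have "p ^ 1 \<le> p ^ multiplicity p i"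
          using p by (intro power_increasing) (auto dest: prime_gt_0_nat)
        then show False using mi False by simp
      qed
      then show ?thesis by simp
    qed
  qed (use i in auto)
  ultimately show thesis using that by blast
qed

lemma card_primes_upto: "card (primes_upto l) = card {p::nat. prime p \<and> p \<le> l}"
proof -
  have "primes_upto l = int ` {p::nat. prime p \<and> p \<le> l}"
  proof (intro set_eqI iffI)
    fix x assume "x \<in> primes_upto l"
    then have "x = int (nat x)" "prime (int (nat x))" "nat x \<le> l"
      by (auto simp: primes_upto_def)
    then show "x \<in> int ` {p::nat. prime p \<and> p \<le> l}"
      by (metis (mono_tags, lifting) imageI mem_Collect_eq prime_nat_int_transfer)
  qed (auto simp: primes_upto_def Suc_le_eq dest: prime_gt_0_nat)
  then show ?thesis by (simp add: card_image)
qed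

lemma chebyshev_lower_bound:
  assumes "l \<ge> 2"
  shows "real l / 3 \<le> real (card (primes_upto l)) * log 2 (real l)"
proof -
  define N where "N = card (primes_upto l)"
  define m where "m = l div 2"
  have m: "m \<ge> 1" "2 * m \<le> l" "real l - 1 \<le> 2 * real m"
    using assms unfolding m_def by linarith+
  have "2 \<in> primes_upto l" using assms by (simp add: primes_upto_def)
  then have N1: "N \<ge> 1"
    unfolding N_def using finite_primes_upto by (metis One_nat_def Suc_leI card_gt_0_iff empty_iff)
  obtain M where M: "M > 0" "M \<le> l ^ N" "\<And>i. 1 \<le> i \<Longrightarrow> i \<le> l \<Longrightarrow> i dvd M"
    using common_multiple_le_power_card_primes[of l] assms unfolding N_def card_primes_upto by auto
  have "m * (2 * m choose m) dvd M"
    using m by (intro mult_binomial_dvd_common_multiple M(3)) auto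
  then have "m * (2 * m choose m) \<le> l ^ N"
    using M dvd_imp_le le_trans by blast
  then have "real (m * (2 * m choose m)) \<le> real (l ^ N)"
    by (simp only: of_nat_le_iff)
  moreover have "4 ^ m / (2 * real m) \<le> real (2 * m choose m)"
    using m by (intro central_binomial_lower_bound) auto
  then have "real m * (4 ^ m / (2 * real m)) \<le> real (m * (2 * m choose m))"
    unfolding of_nat_mult by (intro mult_left_mono) auto
  ultimately have "real m * (4 ^ m / (2 * real m)) \<le> real l ^ N" by simp
  moreover have "real m * (4 ^ m / (2 * real m)) = 2 powr (2 * real m - 1)"
    using m by (simp add: powr_diff powr_mult_base powr_realpow[symmetric] powr_powr[symmetric])
  ultimately have "log 2 (2 powr (2 * real m - 1)) \<le> log 2 (real l ^ N)"
    using assms by (subst log_le_cancel_iff) auto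
  then have "2 * real m - 1 \<le> real N * log 2 (real l)"
    using assms by (simp add: log_nat_power)
  then have "real l - 2 \<le> real N * log 2 (real l)"
    using m by linarith
  moreover have "1 * 1 \<le> real N * log 2 (real l)"
    using N1 assms by (intro mult_mono) auto
  moreover have "l = 2 \<or> real l \<ge> 3" using assms by auto
  ultimately show ?thesis unfolding N_def by auto
qed

section \<open>Upper bound for the number of solutions\<close>

definition ratio_pairs :: "int set \<Rightarrow> int \<Rightarrow> int \<Rightarrow> (int \<times> int) set" where
  "ratio_pairs P s t = {(p, p'). p \<in> P \<and> p' \<in> P \<and> p * s = p' * t}"

text \<open>The \<open>s\<close>-th row sum of \<open>G\<^sup>k\<close>.\<close>

fun walk_count :: "int set \<Rightarrow> int set \<Rightarrow> nat \<Rightarrow> int \<Rightarrow> nat" where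
  "walk_count P S 0 s = 1"
| "walk_count P S (Suc k) s = (\<Sum>t\<in>S. card (ratio_pairs P s t) * walk_count P S k t)"

definition word_pairs :: "int set \<Rightarrow> nat \<Rightarrow> int \<Rightarrow> int \<Rightarrow> (int list \<times> int list) set" where
  "word_pairs P k s t = {(xs, ys). set xs \<subseteq> P \<and> length xs = k \<and> set ys \<subseteq> P \<and> length ys = k \<and>
     prod_list xs * s = prod_list ys * t}"

lemma finite_ratio_pairs: "finite P \<Longrightarrow> finite (ratio_pairs P s t)"
  by (rule finite_subset[of _ "P \<times> P"]) (auto simp: ratio_pairs_def)

lemma finite_word_pairs: "finite P \<Longrightarrow> finite (word_pairs P k s t)"
  by (rule finite_subset[of _ "{xs. set xs \<subseteq> P \<and> length xs = k} \<times> {ys. set ys \<subseteq> P \<and> length ys = k}"])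
     (auto simp: word_pairs_def finite_lists_length_eq)

lemma card_ratio_pairs_commute: "card (ratio_pairs P s t) = card (ratio_pairs P t s)"
proof -
  have "ratio_pairs P t s = prod.swap ` ratio_pairs P s t"
    by (auto simp: ratio_pairs_def image_iff)
  then show ?thesis by (simp add: card_image)
qed

lemma sum_walk_count_mult:
  "(\<Sum>s\<in>S. walk_count P S j s * walk_count P S k s) = (\<Sum>s\<in>S. walk_count P S (j + k) s)"
proof (induction j arbitrary: k)
  case (Suc j)
  have "(\<Sum>s\<in>S. walk_count P S (Suc j) s * walk_count P S k s) =
      (\<Sum>s\<in>S. \<Sum>t\<in>S. card (ratio_pairs P s t) * walk_count P S j t * walk_count P S k s)"
    by (simp add: sum_distrib_right)
  also have "\<dots> = (\<Sum>t\<in>S. \<Sum>s\<in>S. card (ratio_pairs P s t) * walk_count P S j t * walk_count P S k s)"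
    by (rule sum.swap)
  also have "\<dots> = (\<Sum>t\<in>S. walk_count P S j t * walk_count P S (Suc k) t)"
    by (simp add: sum_distrib_left card_ratio_pairs_commute[of P _ "_ :: int"] mult_ac)
  also have "\<dots> = (\<Sum>s\<in>S. walk_count P S (Suc j + k) s)"
    unfolding Suc by simp
  finally show ?case .
qed simp

lemma walk_count_power_le:
  "real (\<Sum>s\<in>S. walk_count P S 1 s) ^ (2 ^ j) \<le>
     real (card S) ^ (2 ^ j - 1) * real (\<Sum>s\<in>S. walk_count P S (2 ^ j) s)"
proof (induction j)
  case (Suc j)
  let ?W = "\<lambda>k. real (\<Sum>s\<in>S. walk_count P S k s)"
  have "?W 1 ^ (2 ^ Suc j) = (?W 1 ^ (2 ^ j))\<^sup>2"
    by (simp add: power_mult[symmetric] mult.commute)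
  also have "\<dots> \<le> (real (card S) ^ (2 ^ j - 1) * ?W (2 ^ j))\<^sup>2"
    by (intro power_mono Suc zero_le_power of_nat_0_le_iff)
  also have "\<dots> = (real (card S) ^ (2 ^ j - 1))\<^sup>2 * (\<Sum>s\<in>S. real (walk_count P S (2 ^ j) s))\<^sup>2"
    by (simp add: power_mult_distrib)
  also have "\<dots> \<le> (real (card S) ^ (2 ^ j - 1))\<^sup>2 *
      ((\<Sum>s\<in>S. (real (walk_count P S (2 ^ j) s))\<^sup>2) * card S)"
    by (intro mult_left_mono sum_squared_le_sum_of_squares) auto
  also have "(\<Sum>s\<in>S. (real (walk_count P S (2 ^ j) s))\<^sup>2) = ?W (2 ^ j + 2 ^ j)"
    unfolding sum_walk_count_mult[symmetric] by (simp add: power2_eq_square)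
  also have "(real (card S) ^ (2 ^ j - 1))\<^sup>2 * (?W (2 ^ j + 2 ^ j) * card S) =
      real (card S) ^ Suc ((2 ^ j - 1) * 2) * ?W (2 ^ Suc j)"
    unfolding power_Suc power_mult mult_2 by (simp only: mult_ac)
  also have "Suc ((2 ^ j - 1) * 2) = 2 ^ Suc j - 1"
    using one_le_power[of "2::nat" j] unfolding power_Suc by arith
  finally show ?case .
qed simp

lemma walk_count_le_word_pairs:
  assumes "finite P" "finite S" "0 \<notin> P" "s \<in> S"
  shows "walk_count P S k s \<le> (\<Sum>u\<in>S. card (word_pairs P k s u))"
  using assms(4)
proof (induction k arbitrary: s)
  case 0
  have "word_pairs P 0 s s = {([], [])}"
    by (auto simp: word_pairs_def)
  then have "1 \<le> card (word_pairs P 0 s s)" by simp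
  also have "\<dots> \<le> (\<Sum>u\<in>S. card (word_pairs P 0 s u))"
    using 0 assms by (intro member_le_sum) auto
  finally show ?case by simp
next
  case (Suc k)
  have "walk_count P S (Suc k) s \<le>
      (\<Sum>t\<in>S. card (ratio_pairs P s t) * (\<Sum>u\<in>S. card (word_pairs P k t u)))"
    unfolding walk_count.simps by (intro sum_mono mult_left_mono Suc.IH) auto
  also have "\<dots> = (\<Sum>u\<in>S. \<Sum>t\<in>S. card (ratio_pairs P s t) * card (word_pairs P k t u))"
    unfolding sum_distrib_left by (rule sum.swap)
  also have "\<dots> \<le> (\<Sum>u\<in>S. card (word_pairs P (Suc k) s u))"
  proof (rule sum_mono)
    fix u assume "u \<in> S"
    let ?A = "SIGMA t:S. ratio_pairs P s t \<times> word_pairs P k t u"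
    have "(\<Sum>t\<in>S. card (ratio_pairs P s t) * card (word_pairs P k t u)) = card ?A"
      using assms by (subst card_SigmaI)
        (auto simp: card_cartesian_product finite_ratio_pairs finite_word_pairs)
    also have "\<dots> \<le> card (word_pairs P (Suc k) s u)"
    proof (rule card_inj_on_le)
      let ?f = "\<lambda>(t::int, (p::int, p'::int), (xs, ys)). (p # xs, p' # ys)"
      show "inj_on ?f ?A"
        using assms(3) by (auto simp: inj_on_def ratio_pairs_def)
      show "?f ` ?A \<subseteq> word_pairs P (Suc k) s u"
      proof (clarsimp simp: ratio_pairs_def word_pairs_def)
        fix t p p' xs ys
        assume *: "p * s = p' * t" "prod_list xs * t = prod_list ys * u"
        have "p * prod_list xs * s = prod_list xs * (p * s)" by simp
        also have "\<dots> = p' * (prod_list xs * t)" by (simp add: *(1))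
        finally show "p * prod_list xs * s = p' * prod_list ys * u" by (simp add: *(2))
      qed
    qed (use assms in \<open>simp add: finite_word_pairs\<close>)
    finally show "(\<Sum>t\<in>S. card (ratio_pairs P s t) * card (word_pairs P k t u))
        \<le> card (word_pairs P (Suc k) s u)" .
  qed
  finally show ?case .
qed

lemma card_prime_lists_with_product_le:
  fixes c :: int
  assumes "\<And>p. p \<in> P \<Longrightarrow> prime p"
  shows "card {xs. set xs \<subseteq> P \<and> length xs = k \<and> prod_list xs = c} \<le> fact k"
proof (cases "{xs. set xs \<subseteq> P \<and> length xs = k \<and> prod_list xs = c} = {}")
  case False
  then obtain zs where zs: "set zs \<subseteq> P" "length zs = k" "prod_list zs = c" by blast
  have "{xs. set xs \<subseteq> P \<and> length xs = k \<and> prod_list xs = c} \<subseteq> permutations_of_multiset (mset zs)"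
  proof clarify
    fix xs assume xs: "set xs \<subseteq> P" "c = prod_list xs"
    have "mset xs = mset zs"
      using xs zs assms by (intro prime_factorization_unique') (auto simp: prod_mset_prod_list)
    then show "xs \<in> permutations_of_multiset (mset zs)"
      by (simp add: permutations_of_multiset_def)
  qed
  then have "card {xs. set xs \<subseteq> P \<and> length xs = k \<and> prod_list xs = c} \<le>
      card (permutations_of_multiset (mset zs))"
    by (intro card_mono) auto
  also have "\<dots> \<le> fact k"
    using zs by (simp add: card_permutations_of_multiset)
  finally show ?thesis .
next
  case True
  then show ?thesis by (simp only: card.empty)
qed

lemma card_word_pairs_le:
  assumes "finite P" "\<And>p. p \<in> P \<Longrightarrow> prime p" "s \<noteq> 0"
  shows "card (word_pairs P k s t) \<le> card P ^ k * fact k"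
proof -
  let ?Y = "{ys. set ys \<subseteq> P \<and> length ys = k}"
  let ?X = "\<lambda>ys. {xs. set xs \<subseteq> P \<and> length xs = k \<and> prod_list xs = prod_list ys * t div s}"
  have fin: "finite ?Y" "finite (?X ys)" for ys
    using finite_lists_length_eq[OF assms(1), of k] by (auto elim: finite_subset[rotated])
  have "card (word_pairs P k s t) \<le> card (SIGMA ys:?Y. ?X ys)"
  proof (rule card_inj_on_le)
    show "inj_on prod.swap (word_pairs P k s t)" by simp
    show "prod.swap ` word_pairs P k s t \<subseteq> (SIGMA ys:?Y. ?X ys)"
    proof (clarsimp simp: word_pairs_def)
      fix xs ys assume "prod_list xs * s = prod_list ys * t"
      then show "prod_list xs = prod_list ys * t div s"
        using assms(3) by (metis nonzero_mult_div_cancel_right)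
    qed
  qed (use fin in auto)
  also have "\<dots> = (\<Sum>ys\<in>?Y. card (?X ys))"
    using fin by (intro card_SigmaI) auto
  also have "\<dots> \<le> of_nat (card ?Y) * fact k"
    using assms(2) by (intro sum_bounded_above card_prime_lists_with_product_le)
  also have "card ?Y = card P ^ k"
    by (rule card_lists_length_eq[OF assms(1)])
  finally show ?thesis by simp
qed

lemma sum_walk_count_one_le:
  assumes P: "finite P" "\<And>p. p \<in> P \<Longrightarrow> prime p" and S: "finite S" "0 \<notin> S"
    and card: "card S \<le> 2 ^ (2 ^ j)"
  shows "real (\<Sum>s\<in>S. walk_count P S 1 s) \<le> 2 * 2 ^ j * real (card P) * real (card S)"
proof (cases "S = {}")
  case False
  define k :: nat where "k = 2 ^ j"
  define n where "n = card S"
  have k: "k > 0" by (simp add: k_def)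
  have n: "n > 0" using False S by (simp add: n_def card_gt_0_iff)
  have "0 \<notin> P" using P(2) by fastforce
  have "(\<Sum>s\<in>S. walk_count P S k s) \<le> (\<Sum>s\<in>S. \<Sum>u\<in>S. card (word_pairs P k s u))"
    using P(1) S(1) \<open>0 \<notin> P\<close> by (intro sum_mono walk_count_le_word_pairs)
  also have "\<dots> \<le> (\<Sum>s\<in>S. \<Sum>u\<in>S. card P ^ k * k ^ k)"
  proof (intro sum_mono)
    fix s u assume "s \<in> S"
    then have "card (word_pairs P k s u) \<le> card P ^ k * fact k"
      using P S by (intro card_word_pairs_le) auto
    also have "\<dots> \<le> card P ^ k * k ^ k"
      using fact_le_power[of k, where 'a = nat] by simp
    finally show "card (word_pairs P k s u) \<le> card P ^ k * k ^ k" .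
  qed
  also have "\<dots> = n * n * (card P * k) ^ k"
    by (simp add: n_def power_mult_distrib)
  also have "\<dots> \<le> 2 ^ k * n * (card P * k) ^ k"
    using card by (intro mult_right_mono) (auto simp: n_def k_def)
  finally have *: "(\<Sum>s\<in>S. walk_count P S k s) \<le> 2 ^ k * n * (card P * k) ^ k" .
  have "real (\<Sum>s\<in>S. walk_count P S 1 s) ^ k \<le> real n ^ (k - 1) * real (\<Sum>s\<in>S. walk_count P S k s)"
    using walk_count_power_le[of P S j] by (simp add: k_def n_def)
  also have "\<dots> \<le> real n ^ (k - 1) * real (2 ^ k * n * (card P * k) ^ k)"
    by (intro mult_left_mono of_nat_mono *) auto
  also have "\<dots> = real n ^ Suc (k - 1) * (2 * (real (card P) * real k)) ^ k"
    by (simp add: power_mult_distrib mult_ac)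
  also have "\<dots> = (2 * real k * real (card P) * real n) ^ k"
    using k by (simp add: power_mult_distrib mult_ac)
  finally have "real (\<Sum>s\<in>S. walk_count P S 1 s) \<le> 2 * real k * real (card P) * real n"
    using k by (subst (asm) power_mono_iff) (simp_all only: of_nat_0_le_iff mult_nonneg_nonneg zero_le_numeral)
  then show ?thesis by (simp add: k_def n_def)
qed simp

lemma card_prime_quadruples_eq:
  assumes "finite S"
  shows "card (prime_quadruples l S) = (\<Sum>s\<in>S. walk_count (primes_upto l) S 1 s)"
proof -
  let ?P = "primes_upto l"
  let ?A = "SIGMA s:S. SIGMA s':S. ratio_pairs ?P s s'"
  let ?f = "\<lambda>(s, s', p, p'). (p, p', s, s')"
  have "prime_quadruples l S = ?f ` ?A"
    by (auto simp: prime_quadruples_def ratio_pairs_def image_iff)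
  moreover have "inj_on ?f ?A" by (auto simp: inj_on_def)
  ultimately have "card (prime_quadruples l S) = card ?A" by (simp add: card_image)
  also have "\<dots> = (\<Sum>s\<in>S. \<Sum>s'\<in>S. card (ratio_pairs ?P s s'))"
    using assms by (simp add: card_SigmaI finite_ratio_pairs finite_primes_upto)
  finally show ?thesis by simp
qed

lemma card_prime_quadruples_le:
  assumes "finite S" "0 \<notin> S"
  shows "real (card (prime_quadruples l S)) \<le>
    4 * max 1 (log 2 (real (card S))) * real (card (primes_upto l)) * real (card S)"
proof (cases "S = {}")
  case False
  define L where "L = max 1 (log 2 (real (card S)))"
  define n where "n = nat \<lceil>L\<rceil>"
  have L: "L \<ge> 1" by (simp add: L_def)
  have n: "n \<ge> 1" "real n < L + 1" "L \<le> real n"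
    using L unfolding n_def by linarith+
  have "\<exists>j. L \<le> 2 ^ j \<and> 2 ^ j \<le> 2 * L"
  proof (cases "n = 1")
    case True
    then show ?thesis using n L by (intro exI[of _ 0]) auto
  next
    case False
    then obtain i where i: "2 ^ i < n" "n \<le> 2 ^ (i + 1)"
      using n ex_power_ivl2[of 2 n] by auto
    have "real (2 ^ i) + 1 \<le> real n"
      using i(1) by linarith
    moreover have "real n \<le> real (2 ^ (i + 1))"
      using i(2) by (simp only: of_nat_le_iff)
    ultimately show ?thesis using n by (intro exI[of _ "i + 1"]) auto
  qed
  then obtain j where j: "L \<le> 2 ^ j" "2 ^ j \<le> 2 * L" by blast
  have c: "card S > 0" using False assms by (simp add: card_gt_0_iff)
  have "real (card S) = 2 powr (log 2 (real (card S)))" using c by simp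
  also have "\<dots> \<le> 2 powr (real (2 ^ j))"
    using j by (intro powr_mono) (auto simp: L_def)
  also have "\<dots> = real (2 ^ (2 ^ j))" by (subst powr_realpow) auto
  finally have "card S \<le> 2 ^ (2 ^ j)" by (simp only: of_nat_le_iff)
  then have "real (card (prime_quadruples l S)) \<le>
      2 * 2 ^ j * real (card (primes_upto l)) * real (card S)"
    unfolding card_prime_quadruples_eq[OF assms(1)] using assms finite_primes_upto
    by (intro sum_walk_count_one_le) (auto simp: primes_upto_def)
  also have "\<dots> \<le> 2 * (2 * L) * real (card (primes_upto l)) * real (card S)"
    using j by (intro mult_right_mono mult_left_mono) auto
  finally show ?thesis by (simp add: L_def)
qed (simp add: card_prime_quadruples_eq)

section \<open>The solution count for small sets\<close>

lemma log2_le_sqrt: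
  fixes x :: real
  assumes "x > 0"
  shows "log 2 x \<le> 4 * sqrt x"
proof -
  have "ln (1 / 2 :: real) \<le> 1 / 2 - 1"
    by (rule ln_le_minus_one) simp
  then have ln2: "ln (2::real) \<ge> 1 / 2"
    by (simp add: ln_div)
  have "ln x = 2 * ln (sqrt x)"
    using assms by (simp add: ln_sqrt)
  also have "\<dots> \<le> 4 * sqrt x * (1 / 2)"
    using assms ln_le_minus_one[of "sqrt x"] by simp
  also have "\<dots> \<le> 4 * sqrt x * ln 2"
    using ln2 assms by (intro mult_left_mono) auto
  finally show ?thesis
    by (simp add: log_def pos_divide_le_eq)
qed

lemma ex_le_div_log2:
  fixes c :: real
  shows "\<exists>l0\<ge>2. \<forall>l\<ge>l0. c \<le> real l / log 2 (real l)"
proof -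
  define l0 where "l0 = max 2 (nat \<lceil>(4 * c)\<^sup>2\<rceil>)"
  have "c \<le> real l / log 2 (real l)" if "l \<ge> l0" for l
  proof -
    have l: "l \<ge> 2" "(4 * c)\<^sup>2 \<le> real l"
      using that unfolding l0_def by linarith+
    have "4 * c \<le> sqrt (real l)"
      using l(2) real_le_rsqrt by blast
    then have "4 * c * sqrt (real l) \<le> sqrt (real l) * sqrt (real l)"
      by (intro mult_right_mono) auto
    then have "c * (4 * sqrt (real l)) \<le> real l" by simp
    moreover have "c * log 2 (real l) \<le> max 0 (c * (4 * sqrt (real l)))"
    proof (cases "c \<ge> 0")
      case True
      then show ?thesis
        using l log2_le_sqrt[of "real l"] by (intro max.coboundedI2 mult_left_mono) auto
    next
      case False
      then show ?thesis
        using l by (intro max.coboundedI1 mult_nonpos_nonneg) auto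
    qed
    ultimately have "c * log 2 (real l) \<le> real l" by simp
    then show ?thesis using l by (simp add: pos_le_divide_eq)
  qed
  then show ?thesis by (intro exI[of _ l0]) (auto simp: l0_def)
qed

lemma prime_quadruples_bound_nonzero:
  fixes \<eta> :: real
  assumes "\<eta> > 0"
  obtains \<rho> :: real and l0 :: nat where "\<rho> > 0"
    "\<And>l S. \<lbrakk>l \<ge> l0; finite S; 0 \<notin> S; log 2 (real (card S)) \<le> \<rho> * (real l / log 2 (real l))\<rbrakk> \<Longrightarrow>
       real (card (prime_quadruples l S)) \<le> \<eta> * real (card (primes_upto l))^2 * real (card S)"
proof -
  obtain l0 :: nat where l0: "l0 \<ge> 2" "\<And>l. l \<ge> l0 \<Longrightarrow> 12 / \<eta> \<le> real l / log 2 (real l)"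
    using ex_le_div_log2 by blast
  show thesis
  proof (rule that[of "\<eta> / 12" l0])
    fix l and S :: "int set"
    assume l: "l \<ge> l0" and S: "finite S" "0 \<notin> S"
      and card: "log 2 (real (card S)) \<le> \<eta> / 12 * (real l / log 2 (real l))"
    define N where "N = real (card (primes_upto l))"
    define q where "q = real l / log 2 (real l)"
    have "log 2 (real l) > 0" using l l0(1) by simp
    then have q: "q \<le> 3 * N"
      using chebyshev_lower_bound[of l] l l0(1) by (simp add: q_def N_def divide_le_eq mult_ac)
    have "12 / \<eta> \<le> q" using l0(2)[OF l] by (simp add: q_def)
    then have "12 \<le> \<eta> * q" using assms by (simp add: pos_divide_le_eq mult.commute)
    then have "4 * max 1 (log 2 (real (card S))) \<le> \<eta> * q / 3"
      using card by (auto simp: q_def[symmetric])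
    also have "\<dots> \<le> \<eta> * N"
      using q assms by simp
    finally have *: "4 * max 1 (log 2 (real (card S))) \<le> \<eta> * N" .
    have "real (card (prime_quadruples l S)) \<le>
        4 * max 1 (log 2 (real (card S))) * N * real (card S)"
      unfolding N_def by (rule card_prime_quadruples_le[OF S])
    also have "\<dots> \<le> \<eta> * N * N * real (card S)"
      using * by (intro mult_right_mono) (auto simp: N_def)
    finally show "real (card (prime_quadruples l S)) \<le>
        \<eta> * real (card (primes_upto l))^2 * real (card S)"
      by (simp add: N_def power2_eq_square mult_ac)
  qed (use assms in simp)
qed

lemma card_prime_quadruples_zero_le:
  assumes "finite S"
  shows "card (prime_quadruples l S) \<le> card (prime_quadruples l (S - {0})) + card (primes_upto l) ^ 2"
proof -
  let ?P = "primes_upto l"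
  let ?Z = "(\<lambda>(p, p'). (p, p', 0::int, 0::int)) ` (?P \<times> ?P)"
  have "prime_quadruples l S \<subseteq> prime_quadruples l (S - {0}) \<union> ?Z"
    by (auto simp: prime_quadruples_def primes_upto_def)
  then have "card (prime_quadruples l S) \<le> card (prime_quadruples l (S - {0}) \<union> ?Z)"
    using assms by (intro card_mono) (auto simp: finite_prime_quadruples finite_primes_upto)
  also have "\<dots> \<le> card (prime_quadruples l (S - {0})) + card ?Z"
    by (rule card_Un_le)
  also have "card ?Z \<le> card (?P \<times> ?P)"
    using finite_primes_upto by (intro card_image_le) auto
  finally show ?thesis by (simp add: card_cartesian_product power2_eq_square)
qed

lemma prime_quadruples_bound:
  fixes \<eta> :: real
  assumes "\<eta> > 0"
  obtains \<rho> :: real and l0 :: nat where "\<rho> > 0"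
    "\<And>l S. \<lbrakk>l \<ge> l0; finite S; 0 \<in> S \<longrightarrow> 1 < \<eta> * real (card S);
       log 2 (real (card S)) \<le> \<rho> * (real l / log 2 (real l))\<rbrakk> \<Longrightarrow>
       real (card (prime_quadruples l S)) \<le> \<eta> * real (card (primes_upto l))^2 * real (card S)"
proof -
  define n0 where "n0 = (LEAST n::nat. 1 < \<eta> * real n)"
  have "\<exists>n::nat. 1 < \<eta> * real n"
    using reals_Archimedean3[OF assms] by (metis mult.commute)
  then have n0: "1 < \<eta> * real n0"
    unfolding n0_def by (rule LeastI_ex)
  then have n0_pos: "n0 > 0" by (cases n0) auto
  have n0_le: "n0 \<le> n" if "1 < \<eta> * real n" for n
    unfolding n0_def using that by (rule Least_le)
  \<comment> \<open>The largest \<open>\<epsilon>\<close> with \<open>1 + \<epsilon> n \<le> \<eta> n\<close> for every integer \<open>n\<close> with \<open>1 < \<eta> n\<close>;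
    the \<open>1\<close> pays for the solutions with \<open>s = s' = 0\<close>.\<close>
  define \<epsilon> where "\<epsilon> = \<eta> - 1 / real n0"
  have \<epsilon>: "\<epsilon> > 0" "\<epsilon> \<le> \<eta>"
    using n0 n0_pos by (auto simp: \<epsilon>_def field_simps)
  have \<epsilon>_le: "1 + \<epsilon> * real n \<le> \<eta> * real n" if "1 < \<eta> * real n" for n
    using n0_le[OF that] n0_pos by (simp add: \<epsilon>_def field_simps)
  obtain \<rho> l0 where \<rho>: "\<rho> > 0" and bound:
    "\<And>l S. \<lbrakk>l \<ge> l0; finite S; 0 \<notin> S; log 2 (real (card S)) \<le> \<rho> * (real l / log 2 (real l))\<rbrakk> \<Longrightarrow>
       real (card (prime_quadruples l S)) \<le> \<epsilon> * real (card (primes_upto l))^2 * real (card S)"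
    using prime_quadruples_bound_nonzero[OF \<epsilon>(1)] by metis
  show thesis
  proof (rule that[OF \<rho>])
    fix l and S :: "int set"
    assume l: "l \<ge> l0" and S: "finite S" "0 \<in> S \<longrightarrow> 1 < \<eta> * real (card S)"
      and card: "log 2 (real (card S)) \<le> \<rho> * (real l / log 2 (real l))"
    define N where "N = real (card (primes_upto l))"
    show "real (card (prime_quadruples l S)) \<le> \<eta> * real (card (primes_upto l))^2 * real (card S)"
    proof (cases "0 \<in> S")
      case False
      then have "real (card (prime_quadruples l S)) \<le> \<epsilon> * N^2 * real (card S)"
        unfolding N_def by (intro bound l S card)
      also have "\<dots> \<le> \<eta> * N^2 * real (card S)"
        using \<epsilon> by (intro mult_right_mono) auto
      finally show ?thesis by (simp add: N_def)
    next
      case True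
      let ?S = "S - {0}"
      have cS: "card ?S \<le> card S" "card S > 0"
        using S(1) True by (auto simp: card_gt_0_iff intro: card_mono)
      then have "log 2 (real (card ?S)) \<le> log 2 (real (card S))"
        by (cases "card ?S = 0") (simp_all add: log_def divide_right_mono)
      then have "real (card (prime_quadruples l ?S)) \<le> \<epsilon> * N^2 * real (card ?S)"
        unfolding N_def using S card by (intro bound l) auto
      also have "\<dots> \<le> \<epsilon> * N^2 * real (card S)"
        using cS \<epsilon> by (intro mult_left_mono) auto
      finally have "real (card (prime_quadruples l S)) \<le> N^2 * (1 + \<epsilon> * real (card S))"
        using card_prime_quadruples_zero_le[OF S(1), of l, folded of_nat_le_iff[where 'a = real]]
        by (simp add: N_def algebra_simps)
      also have "\<dots> \<le> N^2 * (\<eta> * real (card S))"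
        using S(2) True by (intro mult_left_mono \<epsilon>_le) auto
      finally show ?thesis by (simp add: N_def mult_ac)
    qed
  qed
qed

section \<open>Progressions in sets with small product set\<close>

lemma card_power2_le_card_image_mult:
  assumes "finite A"
  shows "real (card A) ^ 2 \<le> real (card (f ` A)) * real (card {(a, b). a \<in> A \<and> b \<in> A \<and> f a = f b})"
proof -
  let ?F = "\<lambda>y. {a \<in> A. f a = y}"
  have "card A = (\<Sum>y\<in>f ` A. card (?F y))"
    unfolding card_eq_sum using assms by (rule sum.image_gen)
  then have "real (card A) ^ 2 = (\<Sum>y\<in>f ` A. real (card (?F y)))\<^sup>2" by simp
  also have "\<dots> \<le> (\<Sum>y\<in>f ` A. (real (card (?F y)))\<^sup>2) * real (card (f ` A))"
    by (rule sum_squared_le_sum_of_squares)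
  also have "(\<Sum>y\<in>f ` A. (real (card (?F y)))\<^sup>2) = real (card (SIGMA y:f ` A. ?F y \<times> ?F y))"
    using assms by (simp add: card_SigmaI card_cartesian_product power2_eq_square)
  also have "card (SIGMA y:f ` A. ?F y \<times> ?F y) = card {(a, b). a \<in> A \<and> b \<in> A \<and> f a = f b}"
    by (rule bij_betw_same_card[of snd], rule bij_betwI[where g = "\<lambda>(a, b). (f a, (a, b))"]) auto
  finally show ?thesis by (simp add: mult.commute)
qed

lemma card_prime_quadruples_ge:
  assumes "finite S"
  shows "(real (card (primes_upto l)) * real (card S)) ^ 2 \<le>
    real (card (primes_upto l * S)) * real (card (prime_quadruples l S))"
proof -
  let ?P = "primes_upto l"
  let ?f = "\<lambda>(p, s). p * s :: int"
  let ?Q = "{(a, b). a \<in> ?P \<times> S \<and> b \<in> ?P \<times> S \<and> ?f a = ?f b}"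
  have "real (card (?P \<times> S)) ^ 2 \<le> real (card (?f ` (?P \<times> S))) * real (card ?Q)"
    using assms finite_primes_upto by (intro card_power2_le_card_image_mult) auto
  moreover have "?f ` (?P \<times> S) = ?P * S"
    by (auto simp: set_times_def image_iff)
  moreover have "card ?Q = card (prime_quadruples l S)"
    by (rule bij_betw_same_card[of "\<lambda>((p, s), (p', s')). (p, p', s, s')"],
        rule bij_betwI[where g = "\<lambda>(p, p', s, s'). ((p, s), (p', s'))"])
      (auto simp: prime_quadruples_def)
  ultimately show ?thesis by (simp add: card_cartesian_product)
qed

lemma card_primes_upto_le_of_small_product_set:
  fixes K :: real and d :: int
  assumes S: "finite S" "card S \<ge> 3" and K: "K \<ge> 1" "real (card (S * S)) \<le> K * real (card S)"
    and d: "d \<noteq> 0" "(\<lambda>i. int i * d) ` {1..n} \<subseteq> S"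
  shows "real (card (primes_upto n)) \<le> 6 * K * log 2 (real (card S))"
proof -
  let ?P = "primes_upto n" and ?S = "S - {0}"
  define N where "N = real (card ?P)"
  define L where "L = log 2 (real (card S))"
  define c where "c = real (card ?S)"
  have "card S - 1 \<le> card ?S" using S(1) by (simp add: card_Diff_singleton_if)
  then have c: "c > 0" "2 * real (card S) \<le> 3 * c"
    using S(2) unfolding c_def by linarith+
  have "(\<lambda>x. d * x) ` (?P * ?S) \<subseteq> S * S"
  proof clarify
    fix x assume "x \<in> ?P * ?S"
    then obtain p s where x: "p \<in> ?P" "s \<in> S" "x = p * s"
      by (auto simp: set_times_def)
    then have "p * d \<in> (\<lambda>i. int i * d) ` {1..n}"
      by (intro image_eqI[of _ _ "nat p"]) (auto simp: primes_upto_def)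
    then have "(p * d) * s \<in> S * S"
      using d(2) x(2) by (intro set_times_intro) auto
    then show "d * x \<in> S * S" by (simp add: x(3) mult_ac)
  qed
  then have "card ((\<lambda>x. d * x) ` (?P * ?S)) \<le> card (S * S)"
    using S(1) by (intro card_mono finite_set_times)
  moreover have "inj_on (\<lambda>x. d * x) (?P * ?S)"
    using d(1) by (auto simp: inj_on_def)
  ultimately have "card (?P * ?S) \<le> card (S * S)"
    by (simp add: card_image)
  then have "real (card (?P * ?S)) \<le> K * real (card S)"
    using K(2) by linarith
  also have "\<dots> \<le> K * (3 / 2 * c)"
    using c K(1) by (intro mult_left_mono) auto
  finally have PS: "real (card (?P * ?S)) \<le> K * (3 / 2 * c)" .
  have "log 2 2 \<le> log 2 (real (card S))"
    using S(2) by (subst log_le_cancel_iff) auto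
  then have L1: "L \<ge> 1" by (simp add: L_def)
  have "log 2 c \<le> L"
    unfolding L_def using c(1) S by (subst log_le_cancel_iff) (auto simp: c_def intro!: card_mono)
  then have "4 * max 1 (log 2 c) * N * c \<le> 4 * L * N * c"
    using L1 c(1) by (intro mult_right_mono) (auto simp: N_def)
  then have Q: "real (card (prime_quadruples n ?S)) \<le> 4 * L * N * c"
    using card_prime_quadruples_le[of ?S n] S(1) by (simp add: N_def c_def)
  have "(N * c)\<^sup>2 \<le> real (card (?P * ?S)) * real (card (prime_quadruples n ?S))"
    unfolding N_def c_def using S(1) by (intro card_prime_quadruples_ge) auto
  also have "\<dots> \<le> (K * (3 / 2 * c)) * (4 * L * N * c)"
    using K(1) c(1) by (intro mult_mono PS Q) auto
  finally have "(N * c\<^sup>2) * N \<le> (N * c\<^sup>2) * (6 * K * L)"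
    by (simp add: power2_eq_square mult_ac)
  moreover have "N = 0 \<or> N * c\<^sup>2 > 0"
    using c(1) by (cases "N = 0") (auto simp: N_def)
  ultimately have "N = 0 \<or> N \<le> 6 * K * L"
    by (auto simp only: mult_le_cancel_left_pos)
  moreover have "0 \<le> 6 * K * L" using K L1 by simp
  ultimately show ?thesis by (auto simp: N_def L_def)
qed

lemma log2_ge_half:
  fixes L :: real
  assumes "L \<ge> 3 / 2"
  shows "log 2 L \<ge> 1 / 2"
proof -
  have "sqrt 2 \<le> 3 / 2"
    by (rule real_le_lsqrt) (auto simp: power2_eq_square)
  then have "log 2 (2 powr (1 / 2)) \<le> log 2 L"
    using assms by (subst log_le_cancel_iff) (auto simp: powr_half_sqrt)
  then show ?thesis by simp
qed

lemma le_mult_log_of_le_mult_log_self: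
  fixes A L x :: real
  assumes x: "x \<ge> 1" "x \<le> A * L * log 2 x" and A: "A \<ge> 1" and L: "L \<ge> 3 / 2"
  shows "x \<le> A * (4 * log 2 (4 * A) + 2) * L * log 2 L"
proof -
  have logL: "log 2 L \<ge> 1 / 2" by (rule log2_ge_half[OF L])
  have AL: "A * L > 0" using A L by simp
  have "sqrt x * sqrt x \<le> A * L * (4 * sqrt x)"
    using x(1) order_trans[OF x(2) mult_left_mono[OF log2_le_sqrt]] AL by simp
  then have "sqrt x * sqrt x \<le> (4 * A * L) * sqrt x" by simp
  then have "sqrt x \<le> 4 * A * L"
    using x(1) by (subst (asm) mult_le_cancel_right) auto
  then have "log 2 (sqrt x) \<le> log 2 (4 * A * L)"
    using x(1) A L by (subst log_le_cancel_iff) auto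
  moreover have "log 2 x = 2 * log 2 (sqrt x)"
    using x(1) by (simp add: log_def ln_sqrt)
  ultimately have "log 2 x \<le> 2 * log 2 (4 * A) + 2 * log 2 L"
    using A L by (simp add: log_mult)
  also have "\<dots> \<le> 2 * log 2 (4 * A) * (2 * log 2 L) + 2 * log 2 L"
  proof -
    have "log 2 (4 * A) \<ge> 0" using A by simp
    then have "2 * log 2 (4 * A) * 1 \<le> 2 * log 2 (4 * A) * (2 * log 2 L)"
      using logL by (intro mult_left_mono) auto
    then show ?thesis by simp
  qed
  also have "\<dots> = (4 * log 2 (4 * A) + 2) * log 2 L" by (simp add: algebra_simps)
  finally have "A * L * log 2 x \<le> A * L * ((4 * log 2 (4 * A) + 2) * log 2 L)"
    using AL by (intro mult_left_mono) auto
  then show ?thesis using x(2) by (simp add: mult_ac)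
qed

lemma ap_from_zero_length_le:
  fixes K :: real
  assumes K: "K \<ge> 1"
  obtains C :: real where "C > 0"
    "\<And>S A k. \<lbrakk>finite S; card S \<ge> 3; real (card (S * S)) \<le> K * real (card S);
       ap_from_zero A k; A \<subseteq> S\<rbrakk> \<Longrightarrow>
       real k \<le> C * log 2 (real (card S)) * log 2 (log 2 (real (card S)))"
proof -
  define B where "B = 18 * K"
  define D where "D = B * (4 * log 2 (4 * B) + 2)"
  have "log 2 (4 * B) \<ge> 0" "B \<ge> 18" using K by (auto simp: B_def)
  then have "18 * 2 \<le> B * (4 * log 2 (4 * B) + 2)" by (intro mult_mono) auto
  then have D: "D \<ge> 36" by (simp add: D_def)
  show thesis
  proof (rule that[of "2 * D"])
    fix S A k
    assume S: "finite S" "card S \<ge> 3" "real (card (S * S)) \<le> K * real (card S)"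
      and A: "ap_from_zero A k" "A \<subseteq> S"
    define L where "L = log 2 (real (card S))"
    have "2 powr (3 / 2) \<le> (3::real)"
    proof (rule power2_le_imp_le)
      have "(2 powr (3 / 2))\<^sup>2 = (2 powr 3 :: real)"
        by (simp add: power2_eq_square powr_add[symmetric] del: powr_numeral)
      then show "(2 powr (3 / 2))\<^sup>2 \<le> (3::real)\<^sup>2" by simp
    qed simp
    then have "log 2 (2 powr (3 / 2)) \<le> log 2 (real (card S))"
      using S(2) by (subst log_le_cancel_iff) auto
    then have L: "L \<ge> 3 / 2" by (simp add: L_def)
    obtain d :: int and n :: nat where d: "d \<noteq> 0" and n: "n \<ge> 1" "k \<le> n + 1"
      and sub: "(\<lambda>i. int i * d) ` {1..n} \<subseteq> S"
      using A unfolding ap_from_zero_def by auto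
    have "real n \<le> D * L * log 2 L"
    proof (cases "n = 1")
      case True
      have "36 * (3 / 2) * (1 / 2) \<le> D * L * log 2 L"
        using D L log2_ge_half[OF L] by (intro mult_mono) auto
      then show ?thesis using True by simp
    next
      case False
      then have n2: "n \<ge> 2" using n by simp
      have "real n / 3 \<le> real (card (primes_upto n)) * log 2 (real n)"
        by (rule chebyshev_lower_bound[OF n2])
      also have "\<dots> \<le> 6 * K * L * log 2 (real n)"
        unfolding L_def using n2
        by (intro mult_right_mono card_primes_upto_le_of_small_product_set[OF S(1,2) K S(3) d sub]) auto
      finally have "real n \<le> B * L * log 2 (real n)" by (simp add: B_def)
      then show ?thesis
        unfolding D_def using n L \<open>B \<ge> 18\<close> by (intro le_mult_log_of_le_mult_log_self) auto
    qed
    moreover have "real k \<le> 2 * real n" using n by linarith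
    ultimately show "real k \<le> 2 * D * log 2 (real (card S)) * log 2 (log 2 (real (card S)))"
      by (simp add: L_def)
  qed (use D in simp)
qed

theorem theorem1:
  shows
    "(\<forall>\<eta>::real. \<eta> > 0 \<longrightarrow>
       (\<exists>\<rho>::real. \<rho> > 0 \<and> (\<exists>l0::nat. \<forall>l\<ge>l0. \<forall>S::int set.
          finite S \<and> (0 \<in> S \<longrightarrow> 1 < \<eta> * real (card S)) \<and>
          log 2 (real (card S)) \<le> \<rho> * (real l / log 2 (real l)) \<longrightarrow>
          real (card (prime_quadruples l S)) \<le> \<eta> * real (card (primes_upto l))^2 * real (card S))))
     \<and>
     (\<forall>K::real. K \<ge> 1 \<longrightarrow>
       (\<exists>C::real. C > 0 \<and> (\<forall>S::int set.
          finite S \<and> card S \<ge> 3 \<and> real (card (S * S)) \<le> K * real (card S) \<longrightarrow>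
          (\<forall>A k. ap_from_zero A k \<and> A \<subseteq> S \<longrightarrow>
             real k \<le> C * log 2 (real (card S)) * log 2 (log 2 (real (card S)))))))"
proof (intro conjI allI impI)
  fix \<eta> :: real assume "\<eta> > 0"
  then show "\<exists>\<rho>>0. \<exists>l0. \<forall>l\<ge>l0. \<forall>S::int set.
      finite S \<and> (0 \<in> S \<longrightarrow> 1 < \<eta> * real (card S)) \<and>
      log 2 (real (card S)) \<le> \<rho> * (real l / log 2 (real l)) \<longrightarrow>
      real (card (prime_quadruples l S)) \<le> \<eta> * real (card (primes_upto l))^2 * real (card S)"
    using prime_quadruples_bound[of \<eta>] by metis
next
  fix K :: real assume "K \<ge> 1"
  then show "\<exists>C>0. \<forall>S::int set.
      finite S \<and> card S \<ge> 3 \<and> real (card (S * S)) \<le> K * real (card S) \<longrightarrow>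
      (\<forall>A k. ap_from_zero A k \<and> A \<subseteq> S \<longrightarrow>
         real k \<le> C * log 2 (real (card S)) * log 2 (log 2 (real (card S))))"
    using ap_from_zero_length_le[of K] by metis
qed

end
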